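(* Let $\boldsymbol{T}$ be any symmetric and honest $n$-player tournament and let $\varepsilon>0$. Then $\boldsymbol{T}$ is $\varepsilon$-close to a tournament $\boldsymbol{T}_f=\boldsymbol{T}_{f,N}$ for some symmetric and honest $n$-player tournament map $f$ (and some positive integer $N$). As a consequence, $\boldsymbol{T}$ is $\varepsilon$-close to a symmetric and honest $n$-player tournament for which (1) the match schedule is fixed; (2) each pair of players meet the same number of times; (3) the tournament satisfies a stronger form of honesty, namely, given the outcomes of all both past and future matches in the tournament, it is never better to lose the current match than to win it (i.e. for every match and every player in it, for any fixed outcomes of all other matches, that player's conditional probability of winning the tournament is at least as large if he wins the match as if he loses it).
   Context: Write $[n]=\{1,\dots,n\}$ for the set of players. Let $\mathcal{M}_n=\{P=(p_{ij})\in[0,1]^{n\times n}: P+P^T=\mathbf{1}\}$, where $\mathbf{1}$ is the all-ones matrix (so $p_{ij}+p_{ji}=1$ and $p_{ii}=\frac12$). Let $\mathcal{P}_n$ be the set of probability vectors in $\mathbb{R}^n$. An $n$-player tournament $\boldsymbol{T}$ is a set of rules (a randomized algorithm) which, one match at a time, announces an unordered pair $\{i,j\}$ of distinct players who then play a match, receives as only information which of the two won (no draws), and eventually announces one of the $n$ players as tournament winner. The choice of the next pair, and of the winner, may depend on the results of earlier matches and on additional randomness. The number of matches is bounded by a constant depending only on $\boldsymbol{T}$. For $P\in\mathcal{M}_n$, the specialization $(\boldsymbol{T},P)$ is the random process in which every match between $i$ and $j$ is won by $i$ with probability $p_{ij}$, independently of the past; $\pi_i(\boldsymbol{T},P)=\pi_i(P)$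 is the probability that player $i$ wins the tournament. Symmetric tournament: for every $P\in\mathcal{M}_n$, every permutation $\sigma$ of $[n]$ and every $i\in[n]$, $\pi_i(P)=\pi_{\sigma(i)}(Q)$, where $Q\in\mathcal{M}_n$ is defined by $q_{\sigma(i)\sigma(j)}=p_{ij}$. Honest tournament: for every possible state of $\boldsymbol{T}$ in which $r\ge0$ matches have been played and a pair $\{i,j\}$ has just been announced for match $r+1$ (the state includes the results of the previous matches and all random choices already made by the rules), and every $P\in\mathcal{M}_n$, one has $\pi_i^+(P)\ge\pi_i^-(P)$, where $\pi_i^+(P)$ (resp. $\pi_i^-(P)$) is the probability that $i$ wins the tournament conditioned on the current state and on $i$ winning (resp. losing) match $r+1$, with all subsequent matches decided according to $P$. Two $n$-player tournaments $\boldsymbol{T}_1,\boldsymbol{T}_2$ are $\varepsilon$-close if $|\pi_i(\boldsymbol{T}_1,P)-\pi_i(\boldsymbol{T}_2,P)|<\varepsilon$ for all $i\in[n]$ and $P\in\mathcal{M}_n$. An $n$-player tournament map is a continuous function $f=(f_1,\dots,f_n):\mathcal{M}_n\to\mathcal{P}_n$. It is symmetric if $f_i(P)=f_{\sigma(i)}(Q)$ for all $P\in\mathcal{M}_n$, permutations $\sigma$ of $[n]$ and $i\in[n]$, with $Q$ defined by $q_{\sigma(i)\sigma(j)}=p_{ij}$. It is honest if for any distinct $i,j\in[n]$, $f_i(P)$ is (weakly) increasing in $p_{ij}$ (when $p_{ij}$ is increased, $p_{ji}=1-p_{ij}$ is changed accordingly and all other entries are kept fixed). For a tournament map $f$ and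 a positive integer $N$, the tournament $\boldsymbol{T}_f=\boldsymbol{T}_{f,N}$ is: play $N$ iterations of round-robin (every pair of players meets once in each iteration); let $\hat p_{ij}$ be the fraction of matches that $i$ won against $j$, and $\hat P\in\mathcal{M}_n$ the corresponding matrix; choose the tournament winner at random from the distribution $f(\hat P)$. *)

theory Defs
  imports "HOL-Probability.Probability"
begin

text \<open>
  The players are the elements of an arbitrary finite type \<open>'n\<close>, so the number of players is
  \<open>CARD('n)\<close>.
\<close>

definition game_matrices :: "(real^'n^'n) set" where
  "game_matrices = {P. (\<forall>i j. 0 \<le> P $ i $ j \<and> P $ i $ j \<le> 1) \<and> P + transpose P = (\<chi> i j. 1)}"

definition probability_vectors :: "(real^'n) set" where
  "probability_vectors = {x. (\<forall>i. 0 \<le> x $ i) \<and> (\<Sum>i\<in>UNIV. x $ i) = 1}"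

text \<open>
  A tournament is represented by its decision tree. \<open>Play i j s t\<close> announces the pair \<open>{i, j}\<close> and
  continues with \<open>s\<close> if \<open>i\<close> wins and with \<open>t\<close> if \<open>j\<close> wins. \<open>Randomize M k\<close> makes a random choice
  \<open>\<omega>\<close> according to an arbitrary probability measure \<open>M\<close>, not necessarily discrete, and continues with
  \<open>k \<omega>\<close>; the possible values of the choice are the points of \<open>space M\<close>. The position in the tree thus
  encodes the results of all previous matches and all random choices already made.
\<close>

datatype ('n, 'r) rules =
    Winner 'n
  | Play 'n 'n "('n, 'r) rules" "('n, 'r) rules"
  | Randomize "'r measure" "'r \<Rightarrow> ('n, 'r) rules"

text \<open>
  The law of the pair (match results, tournament winner) when the matches are decided according to
  \<open>P\<close>. The results are listed in order of play; the entry \<open>(i, j)\<close> records that \<open>i\<close> has beaten \<open>j\<close>.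
\<close>

primrec specialization ::
    "('n::finite, 'r) rules \<Rightarrow> real^'n^'n \<Rightarrow> (('n \<times> 'n) list \<times> 'n) measure" where
  "specialization (Winner i) P = return (count_space UNIV) ([], i)"
| "specialization (Play i j s t) P =
     measure_pmf (bernoulli_pmf (P $ i $ j)) \<bind>
       (\<lambda>b. if b then distr (specialization s P) (count_space UNIV) (\<lambda>(h, w). ((i, j) # h, w))
            else distr (specialization t P) (count_space UNIV) (\<lambda>(h, w). ((j, i) # h, w)))"
| "specialization (Randomize M k) P = M \<bind> (\<lambda>\<omega>. specialization (k \<omega>) P)"

definition win_prob :: "('n::finite, 'r) rules \<Rightarrow> real^'n^'n \<Rightarrow> 'n \<Rightarrow> real" where
  "win_prob T P i = \<P>(x in specialization T P. snd x = i)"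

text \<open>The measurability condition makes the specialization of a \<open>Randomize\<close> node meaningful.\<close>

primrec well_formed :: "('n::finite, 'r) rules \<Rightarrow> bool" where
  "well_formed (Winner i) \<longleftrightarrow> True"
| "well_formed (Play i j s t) \<longleftrightarrow> i \<noteq> j \<and> well_formed s \<and> well_formed t"
| "well_formed (Randomize M k) \<longleftrightarrow>
     prob_space M \<and> (\<forall>\<omega>\<in>space M. well_formed (k \<omega>)) \<and>
     (\<forall>P\<in>game_matrices. (\<lambda>\<omega>. specialization (k \<omega>) P) \<in> M \<rightarrow>\<^sub>M prob_algebra (count_space UNIV))"

text \<open>The possible sequences of announced unordered pairs.\<close>

primrec schedules :: "('n, 'r) rules \<Rightarrow> 'n set list set" where
  "schedules (Winner i) = {[]}"
| "schedules (Play i j s t) = (\<lambda>S. {i, j} # S) ` (schedules s \<union> schedules t)"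
| "schedules (Randomize M k) = (\<Union>\<omega>\<in>space M. schedules (k \<omega>))"

definition tournament :: "('n::finite, 'r) rules \<Rightarrow> bool" where
  "tournament T \<longleftrightarrow> well_formed T \<and> (\<exists>B. \<forall>S\<in>schedules T. length S \<le> B)"

definition symmetric_tournament :: "('n::finite, 'r) rules \<Rightarrow> bool" where
  "symmetric_tournament T \<longleftrightarrow>
     (\<forall>P\<in>game_matrices. \<forall>Q\<in>game_matrices. \<forall>\<sigma>. bij \<sigma> \<longrightarrow> (\<forall>i j. Q $ \<sigma> i $ \<sigma> j = P $ i $ j) \<longrightarrow>
        (\<forall>i. win_prob T P i = win_prob T Q (\<sigma> i)))"

text \<open>The possible states, each represented by the rules for the remainder of the tournament.\<close>

primrec states :: "('n, 'r) rules \<Rightarrow> ('n, 'r) rules set" where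
  "states (Winner i) = {Winner i}"
| "states (Play i j s t) = {Play i j s t} \<union> states s \<union> states t"
| "states (Randomize M k) = {Randomize M k} \<union> (\<Union>\<omega>\<in>space M. states (k \<omega>))"

definition honest_tournament :: "('n::finite, 'r) rules \<Rightarrow> bool" where
  "honest_tournament T \<longleftrightarrow>
     (\<forall>i j s t. Play i j s t \<in> states T \<longrightarrow>
        (\<forall>P\<in>game_matrices. win_prob s P i \<ge> win_prob t P i \<and> win_prob t P j \<ge> win_prob s P j))"

definition eps_close :: "real \<Rightarrow> ('n::finite, 'r) rules \<Rightarrow> ('n, 's) rules \<Rightarrow> bool" where
  "eps_close \<epsilon> T\<^sub>1 T\<^sub>2 \<longleftrightarrow> (\<forall>i. \<forall>P\<in>game_matrices. \<bar>win_prob T\<^sub>1 P i - win_prob T\<^sub>2 P i\<bar> < \<epsilon>)"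

definition fixed_schedule :: "('n, 'r) rules \<Rightarrow> bool" where
  "fixed_schedule T \<longleftrightarrow> (\<exists>S. schedules T = {S})"

definition equal_meetings :: "('n, 'r) rules \<Rightarrow> bool" where
  "equal_meetings T \<longleftrightarrow>
     (\<forall>S\<in>schedules T. \<exists>c. \<forall>i j. i \<noteq> j \<longrightarrow> count_list S {i, j} = c)"

text \<open>
  The two result lists compared here differ only in one match between \<open>i\<close> and \<open>j\<close>. The positivity
  conditions make both conditional probabilities meaningful; if all off-diagonal entries of \<open>P\<close> lie
  strictly between 0 and 1 and the schedule is fixed, they hold for all result lists compatible with
  the schedule.
\<close>

definition strongly_honest :: "('n::finite, 'r) rules \<Rightarrow> bool" where
  "strongly_honest T \<longleftrightarrow>
     (\<forall>P\<in>game_matrices. \<forall>i j past future.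
        \<P>(x in specialization T P. fst x = past @ [(i, j)] @ future) > 0 \<longrightarrow>
        \<P>(x in specialization T P. fst x = past @ [(j, i)] @ future) > 0 \<longrightarrow>
        \<P>(x in specialization T P. snd x = i \<bar> fst x = past @ [(i, j)] @ future)
          \<ge> \<P>(x in specialization T P. snd x = i \<bar> fst x = past @ [(j, i)] @ future))"

definition tournament_map :: "(real^'n^'n \<Rightarrow> real^'n) \<Rightarrow> bool" where
  "tournament_map f \<longleftrightarrow> continuous_on game_matrices f \<and> f ` game_matrices \<subseteq> probability_vectors"

definition symmetric_map :: "(real^'n^'n \<Rightarrow> real^'n) \<Rightarrow> bool" where
  "symmetric_map f \<longleftrightarrow>
     (\<forall>P\<in>game_matrices. \<forall>Q\<in>game_matrices. \<forall>\<sigma>. bij \<sigma> \<longrightarrow> (\<forall>i j. Q $ \<sigma> i $ \<sigma> j = P $ i $ j) \<longrightarrow>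
        (\<forall>i. f P $ i = f Q $ \<sigma> i))"

definition honest_map :: "(real^'n^'n \<Rightarrow> real^'n) \<Rightarrow> bool" where
  "honest_map f \<longleftrightarrow>
     (\<forall>i j. i \<noteq> j \<longrightarrow> (\<forall>P\<in>game_matrices. \<forall>Q\<in>game_matrices.
        P $ i $ j \<le> Q $ i $ j \<longrightarrow> (\<forall>k l. {k, l} \<noteq> {i, j} \<longrightarrow> Q $ k $ l = P $ k $ l) \<longrightarrow>
        f P $ i \<le> f Q $ i))"

text \<open>An order of play for one iteration of round-robin.\<close>

definition round_robin :: "('n \<times> 'n) list \<Rightarrow> bool" where
  "round_robin ps \<longleftrightarrow>
     (\<forall>(i, j)\<in>set ps. i \<noteq> j) \<and>
     (\<forall>i j. i \<noteq> j \<longrightarrow> count_list (map (\<lambda>(i, j). {i, j}) ps) {i, j} = 1)"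

lemma round_robin_exists: "\<exists>ps :: ('n::finite \<times> 'n) list. round_robin ps"
proof -
  define A :: "'n set set" where "A = {{i, j} | i j. i \<noteq> j}"
  obtain xs where xs: "set xs = A" "distinct xs"
    using finite_distinct_list[of A] by auto
  define g :: "'n set \<Rightarrow> 'n \<times> 'n" where "g e = (SOME p. e = {fst p, snd p} \<and> fst p \<noteq> snd p)" for e
  have g: "e = {fst (g e), snd (g e)} \<and> fst (g e) \<noteq> snd (g e)" if "e \<in> A" for e
    unfolding g_def by (rule someI_ex) (use that in \<open>force simp: A_def\<close>)
  have "map (\<lambda>(i, j). {i, j}) (map g xs) = xs"
    using g xs(1) by (auto simp: case_prod_unfold intro!: map_idI)
  moreover have "count_list xs {i, j} = 1" if "i \<noteq> j" for i j
  proof -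
    have "{i, j} \<in> set xs" using that xs by (auto simp: A_def)
    then show ?thesis using xs(2) by (simp flip: count_mset add: distinct_count_atmost_1)
  qed
  ultimately have "round_robin (map g xs)"
    unfolding round_robin_def using g xs(1) by (auto simp: case_prod_unfold)
  then show ?thesis ..
qed

text \<open>Play the matches in the given order, then continue depending on the list of results.\<close>

primrec play_all ::
    "('n \<times> 'n) list \<Rightarrow> (('n \<times> 'n) list \<Rightarrow> ('n, 'r) rules) \<Rightarrow> ('n, 'r) rules" where
  "play_all [] c = c []"
| "play_all (p # ps) c =
     Play (fst p) (snd p) (play_all ps (\<lambda>h. c ((fst p, snd p) # h)))
       (play_all ps (\<lambda>h. c ((snd p, fst p) # h)))"

definition empirical_matrix :: "nat \<Rightarrow> ('n \<times> 'n) list \<Rightarrow> real^'n^'n" where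
  "empirical_matrix N h = (\<chi> i j. if i = j then 1/2 else real (count_list h (i, j)) / real N)"

definition map_tournament ::
    "(real^'n^'n \<Rightarrow> real^'n) \<Rightarrow> nat \<Rightarrow> ('n \<times> 'n) list \<Rightarrow> ('n, 'n) rules" where
  "map_tournament f N ps =
     play_all (concat (replicate N ps))
       (\<lambda>h. Randomize (point_measure UNIV (\<lambda>i. ennreal (f (empirical_matrix N h) $ i))) Winner)"

end

theory Submission
  imports Defs
begin

text \<open>
  Take \<open>f\<close> to be the vector of winning probabilities of \<open>T\<close> itself. Since the tree of \<open>T\<close> has bounded
  depth, \<open>f\<close> is Lipschitz; honesty of \<open>T\<close> at every state makes \<open>f\<close> honest, by induction on the tree.
  Player \<open>i\<close> wins \<open>T\<^sub>f\<close> with probability equal to the mean of \<open>f\<^sub>i\<close> at the empirical matrix, which by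
  Chebyshev and the Lipschitz property is uniformly close to \<open>f\<^sub>i(P)\<close>. The result of \<open>T\<^sub>f\<close> depends only
  on the numbers of wins, so symmetry is inherited although the order of play is not symmetric; and
  winning one more match only increases one entry of the empirical matrix, which gives strong honesty.
\<close>

section \<open>Winning probabilities of a decision tree\<close>

lemma game_matricesI:
  assumes "\<And>i j. 0 \<le> P $ i $ j" "\<And>i j. P $ i $ j + P $ j $ i = 1"
  shows "P \<in> game_matrices"
proof -
  have "P $ i $ j \<le> 1" for i j
    using assms(1)[of j i] assms(2)[of i j] by linarith
  then show ?thesis
    using assms by (simp add: game_matrices_def vec_eq_iff transpose_def)
qed

lemma game_matricesD:
  assumes "P \<in> game_matrices"
  shows "0 \<le> P $ i $ j" "P $ i $ j \<le> 1" "P $ j $ i = 1 - P $ i $ j"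
  using assms by (auto simp: game_matrices_def vec_eq_iff transpose_def eq_diff_eq add.commute)

text \<open>Membership in \<open>prob_algebra\<close> bundles total mass 1 with the discrete
  sigma-algebra, the form in which the bind rules pass it up the tree. At \<open>Play\<close> the
  kernel starts from a discrete space, so its measurability is free; at \<open>Randomize\<close> it
  is part of \<open>well_formed\<close>.\<close>

lemma specialization_in_prob_algebra:
  assumes "well_formed T" "P \<in> game_matrices"
  shows "specialization T P \<in> space (prob_algebra (count_space UNIV))"
  using assms
proof (induction T)
  case (Winner i)
  then show ?case
    by (auto simp: space_prob_algebra intro!: prob_space_return)
next
  case (Play i j s t)
  have d: "distr (specialization u P) (count_space UNIV) g \<in> space (prob_algebra (count_space UNIV))"
    if "specialization u P \<in> space (prob_algebra (count_space UNIV))" for u and g :: "_ \<Rightarrow> ('a \<times> 'a) list \<times> 'a"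
    using that sets_eq_imp_space_eq[of "specialization u P" "count_space UNIV"]
    by (auto simp: space_prob_algebra measurable_def intro!: prob_space.prob_space_distr)
  have B: "(\<lambda>b. if b then distr (specialization s P) (count_space UNIV) (\<lambda>(h, w). ((i, j) # h, w))
            else distr (specialization t P) (count_space UNIV) (\<lambda>(h, w). ((j, i) # h, w)))
     \<in> measure_pmf (bernoulli_pmf (P $ i $ j)) \<rightarrow>\<^sub>M prob_algebra (count_space UNIV)"
    using Play d by (auto simp: measurable_def)
  have A: "measure_pmf (bernoulli_pmf (P $ i $ j)) \<in> space (prob_algebra (measure_pmf (bernoulli_pmf (P $ i $ j))))"
    by (simp add: space_prob_algebra measure_pmf.prob_space_axioms del: sets_measure_pmf)
  show ?case
    using prob_space_bind'[OF A B] sets_bind'[OF A B] by (simp add: space_prob_algebra)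
next
  case (Randomize M k)
  then have A: "M \<in> space (prob_algebra M)"
    and B: "(\<lambda>\<omega>. specialization (k \<omega>) P) \<in> M \<rightarrow>\<^sub>M prob_algebra (count_space UNIV)"
    by (auto simp: space_prob_algebra)
  show ?case
    using prob_space_bind'[OF A B] sets_bind'[OF A B] by (simp add: space_prob_algebra)
qed

lemma prob_space_specialization:
  assumes "well_formed T" "P \<in> game_matrices"
  shows "prob_space (specialization T P)" and "sets (specialization T P) = UNIV"
    and "space (specialization T P) = UNIV"
  using specialization_in_prob_algebra[OF assms] sets_eq_imp_space_eq[of "specialization T P" "count_space UNIV"]
  by (auto simp: space_prob_algebra)

text \<open>Total probability over the first result, with the event pulled back along prepending it.
  Events are arbitrary, not only those about the winner, because strong honesty conditions on the
  history.\<close>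

lemma measure_specialization_Play:
  assumes "well_formed (Play i j s t)" "P \<in> game_matrices"
  shows "measure (specialization (Play i j s t) P) A =
     P $ i $ j * measure (specialization s P) {(h, w). ((i, j) # h, w) \<in> A} +
     (1 - P $ i $ j) * measure (specialization t P) {(h, w). ((j, i) # h, w) \<in> A}"
proof -
  define g where "g b = (if b then distr (specialization s P) (count_space UNIV) (\<lambda>(h, w). ((i, j) # h, w))
            else distr (specialization t P) (count_space UNIV) (\<lambda>(h, w). ((j, i) # h, w)))" for b
  note S = prob_space_specialization[of s, OF _ assms(2)] and T = prob_space_specialization[of t, OF _ assms(2)]
  have m: "f \<in> specialization s P \<rightarrow>\<^sub>M count_space UNIV" "f \<in> specialization t P \<rightarrow>\<^sub>M count_space UNIV"
    for f :: "_ \<Rightarrow> ('a \<times> 'a) list \<times> 'a"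
    using S T assms(1) by (auto simp: measurable_def)
  have "g \<in> measure_pmf (bernoulli_pmf (P $ i $ j)) \<rightarrow>\<^sub>M subprob_algebra (count_space UNIV)"
    using S T assms(1) m
    by (auto simp: measurable_def g_def space_subprob_algebra
        intro!: prob_space_imp_subprob_space prob_space.prob_space_distr)
  then have "measure (measure_pmf (bernoulli_pmf (P $ i $ j)) \<bind> g) A = (\<integral>b. measure (g b) A \<partial>measure_pmf (bernoulli_pmf (P $ i $ j)))"
    by (intro subprob_space.measure_bind[where N="count_space UNIV"]) (auto intro: prob_space_imp_subprob_space measure_pmf.prob_space_axioms)
  also have "\<dots> = P $ i $ j * measure (g True) A + (1 - P $ i $ j) * measure (g False) A"
    using game_matricesD(1,2)[OF assms(2)] by simp
  finally show ?thesis
    using m S T assms(1) by (simp add: g_def[abs_def] measure_distr vimage_def case_prod_unfold)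
qed

text \<open>Integrability comes along because later arguments subtract and compare such integrals;
  the integrand is the kernel followed by evaluation at \<open>A\<close>, bounded by 1.\<close>

lemma measure_specialization_Randomize:
  assumes "well_formed (Randomize M k)" "P \<in> game_matrices"
  shows "measure (specialization (Randomize M k) P) A = (\<integral>\<omega>. measure (specialization (k \<omega>) P) A \<partial>M)"
    and "integrable M (\<lambda>\<omega>. measure (specialization (k \<omega>) P) A)"
proof -
  interpret prob_space M using assms by simp
  have *: "(\<lambda>\<omega>. specialization (k \<omega>) P) \<in> M \<rightarrow>\<^sub>M subprob_algebra (count_space UNIV)"
    using assms by (auto intro: measurable_prob_algebraD)
  then show "measure (specialization (Randomize M k) P) A = (\<integral>\<omega>. measure (specialization (k \<omega>) P) A \<partial>M)"
    by (simp add: subprob_space.measure_bind[where N="count_space UNIV"] prob_space_imp_subprob_space prob_space_axioms)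
  show "integrable M (\<lambda>\<omega>. measure (specialization (k \<omega>) P) A)"
  proof (rule integrable_const_bound[where B=1])
    have "(\<lambda>\<omega>. measure (specialization (k \<omega>) P) A) = (\<lambda>N. measure N A) \<circ> (\<lambda>\<omega>. specialization (k \<omega>) P)"
      by (simp add: comp_def)
    also have "\<dots> \<in> borel_measurable M"
      by (rule measurable_comp[OF *]) simp
    finally show "(\<lambda>\<omega>. measure (specialization (k \<omega>) P) A) \<in> borel_measurable M" .
    show "AE \<omega> in M. norm (measure (specialization (k \<omega>) P) A) \<le> 1"
      using assms prob_space_specialization(1)
      by (intro AE_I2) (auto intro!: prob_space.prob_le_1)
  qed
qed

section \<open>Recursion for the winning probabilities\<close>

lemma win_prob_eq:
  assumes "well_formed T" "P \<in> game_matrices"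
  shows "win_prob T P i = measure (specialization T P) {(h, w). w = i}"
  using prob_space_specialization(3)[OF assms] by (simp add: win_prob_def case_prod_unfold)

lemma win_prob_Winner: "win_prob (Winner i) P j = (if i = j then 1 else 0)"
  by (auto simp: win_prob_def measure_return)

lemma win_prob_Play:
  assumes "well_formed (Play i j s t)" "P \<in> game_matrices"
  shows "win_prob (Play i j s t) P l = P $ i $ j * win_prob s P l + (1 - P $ i $ j) * win_prob t P l"
  using measure_specialization_Play[OF assms, of "{(h, w). w = l}"] assms
  by (simp add: win_prob_eq del: specialization.simps)

lemma win_prob_Randomize:
  assumes "well_formed (Randomize M k)" "P \<in> game_matrices"
  shows "win_prob (Randomize M k) P l = (\<integral>\<omega>. win_prob (k \<omega>) P l \<partial>M)"
    and "integrable M (\<lambda>\<omega>. win_prob (k \<omega>) P l)"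
  using measure_specialization_Randomize[OF assms, of "{(h, w). w = l}"] assms
  by (auto simp: win_prob_eq simp del: specialization.simps cong: Bochner_Integration.integral_cong Bochner_Integration.integrable_cong)

lemma win_prob_bounds:
  assumes "well_formed T" "P \<in> game_matrices"
  shows "0 \<le> win_prob T P i" "win_prob T P i \<le> 1"
  using prob_space.prob_le_1[OF prob_space_specialization(1)[OF assms]] by (auto simp: win_prob_def)

lemma sum_win_prob:
  assumes "well_formed T" "P \<in> game_matrices"
  shows "(\<Sum>i\<in>UNIV. win_prob T P i) = 1"
proof -
  interpret prob_space "specialization T P" by (rule prob_space_specialization[OF assms])
  note [simp] = prob_space_specialization(2,3)[OF assms]
  have "(\<Sum>i\<in>UNIV. win_prob T P i) = prob (\<Union>i\<in>UNIV. {(h, w). w = i})"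
    by (subst finite_measure_finite_Union) (auto simp: disjoint_family_on_def win_prob_eq[OF assms])
  also have "(\<Union>i\<in>UNIV. {(h, w). w = i}) = space (specialization T P)"
    by auto
  finally show ?thesis by (simp only: prob_space)
qed

section \<open>Dependence of the winning probabilities on the matrix\<close>

text \<open>Guarantees in the next induction that a bound on schedule lengths at a
  \<open>Play\<close> node is at least 1. For \<open>Randomize\<close> it holds since a probability
  space has a point.\<close>

lemma schedules_nonempty: "well_formed T \<Longrightarrow> schedules T \<noteq> {}"
proof (induction T)
  case (Randomize M k)
  then show ?case using prob_space.not_empty[of M] by auto
qed auto

text \<open>Each match of the tree can change the winning probabilities by at most \<open>\<bar>P $ i $ j - Q $ i $ j\<bar>\<close>.\<close>

lemma win_prob_Lipschitz:
  assumes "well_formed T" "P \<in> game_matrices" "Q \<in> game_matrices"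
    and "\<forall>S\<in>schedules T. length S \<le> B"
    and "\<And>i j. \<bar>P $ i $ j - Q $ i $ j\<bar> \<le> d"
  shows "\<bar>win_prob T P l - win_prob T Q l\<bar> \<le> real B * d"
  using assms(1,4)
proof (induction T arbitrary: B)
  case (Winner i)
  have "0 \<le> d" using assms(5)[of undefined undefined] by linarith
  then show ?case by (simp add: win_prob_Winner)
next
  case (Play i j s t)
  then obtain S where "S \<in> schedules s"
    using schedules_nonempty[of s] by auto
  \<comment> \<open>One unit of \<open>B\<close> pays for the current match, the remaining
    \<open>B'\<close> bounds both subtrees.\<close>
  with Play.prems obtain B' where B: "B = Suc B'"
    by (cases B) auto
  define p q where "p = P $ i $ j" and "q = Q $ i $ j"
  have p: "0 \<le> p" "p \<le> 1" and q: "0 \<le> q" "q \<le> 1"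
    using assms(2,3) by (auto simp: p_def q_def game_matricesD(1,2))
  define x x' y y' where "x = win_prob s P l" and "x' = win_prob t P l"
    and "y = win_prob s Q l" and "y' = win_prob t Q l"
  have IH: "\<bar>x - y\<bar> \<le> real B' * d" "\<bar>x' - y'\<bar> \<le> real B' * d"
    using Play B by (auto simp: x_def x'_def y_def y'_def)
  have "\<bar>x - x'\<bar> \<le> 1"
    using win_prob_bounds[of s P l] win_prob_bounds[of t P l] Play.prems assms(2)
    by (auto simp: x_def x'_def abs_le_iff)
  then have "\<bar>p - q\<bar> * \<bar>x - x'\<bar> \<le> d"
    using assms(5)[of i j] mult_mono[of "\<bar>p - q\<bar>" d "\<bar>x - x'\<bar>" 1] by (simp add: p_def q_def)
  moreover have "q * \<bar>x - y\<bar> + (1 - q) * \<bar>x' - y'\<bar> \<le> real B' * d"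
    using IH q by (intro convex_bound_le) auto
  \<comment> \<open>First summand: the changed odds of this match, at most \<open>d\<close> since
    \<open>x\<close> and \<open>x'\<close> lie in the unit interval. Second: a convex combination,
    with weights from \<open>Q\<close>, of the changes in the subtrees.\<close>
  moreover have "p * x + (1 - p) * x' - (q * y + (1 - q) * y') =
      (p - q) * (x - x') + (q * (x - y) + (1 - q) * (x' - y'))"
    by (simp add: algebra_simps)
  moreover have "\<bar>(p - q) * (x - x') + (q * (x - y) + (1 - q) * (x' - y'))\<bar> \<le>
      \<bar>p - q\<bar> * \<bar>x - x'\<bar> + (q * \<bar>x - y\<bar> + (1 - q) * \<bar>x' - y'\<bar>)"
    using q by (intro order_trans[OF abs_triangle_ineq] add_mono) (simp_all add: abs_mult)
  ultimately have "\<bar>p * x + (1 - p) * x' - (q * y + (1 - q) * y')\<bar> \<le> real B * d"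
    by (simp add: B algebra_simps)
  then show ?case
    using Play.prems assms(2,3)
    by (simp add: win_prob_Play p_def q_def x_def x'_def y_def y'_def del: specialization.simps)
next
  case (Randomize M k)
  interpret prob_space M using Randomize by simp
  note W = win_prob_Randomize[OF Randomize.prems(1)]
  have "\<bar>win_prob (Randomize M k) P l - win_prob (Randomize M k) Q l\<bar> =
      \<bar>\<integral>\<omega>. win_prob (k \<omega>) P l - win_prob (k \<omega>) Q l \<partial>M\<bar>"
    using assms(2,3) by (simp add: W)
  also have "\<dots> \<le> (\<integral>\<omega>. \<bar>win_prob (k \<omega>) P l - win_prob (k \<omega>) Q l\<bar> \<partial>M)"
    by (rule integral_abs_bound)
  also have "\<dots> \<le> (\<integral>\<omega>. real B * d \<partial>M)"
  proof (rule integral_mono)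
    show "integrable M (\<lambda>\<omega>. \<bar>win_prob (k \<omega>) P l - win_prob (k \<omega>) Q l\<bar>)"
      using W(2) assms(2,3) by (intro integrable_abs Bochner_Integration.integrable_diff)
    show "\<bar>win_prob (k \<omega>) P l - win_prob (k \<omega>) Q l\<bar> \<le> real B * d" if "\<omega> \<in> space M" for \<omega>
      using Randomize.prems that by (intro Randomize.IH) auto
  qed simp
  finally show ?case by (simp add: prob_space)
qed


text \<open>At a match, first pass from \<open>P\<close> to \<open>Q\<close> inside the subtrees
  (induction), then in the odds of the match itself, where honesty of this state under
  \<open>Q\<close> gives the sign. Honesty passes to subtrees because their states are states of the
  whole tree.\<close>

lemma win_prob_mono:
  assumes "well_formed T" "honest_tournament T" "P \<in> game_matrices" "Q \<in> game_matrices"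
    and le: "P $ i $ j \<le> Q $ i $ j" and eq: "\<And>k l. {k, l} \<noteq> {i, j} \<Longrightarrow> Q $ k $ l = P $ k $ l"
  shows "win_prob T P i \<le> win_prob T Q i"
  using assms(1,2)
proof (induction T)
  case (Winner i)
  then show ?case by (simp add: win_prob_Winner)
next
  case (Play a b s t)
  define p q where "p = P $ a $ b" and "q = Q $ a $ b"
  have p: "0 \<le> p" "p \<le> 1"
    using assms(3) by (auto simp: p_def game_matricesD(1,2))
  have H: "win_prob t Q a \<le> win_prob s Q a" "win_prob s Q b \<le> win_prob t Q b"
    using Play.prems assms(4) by (auto simp: honest_tournament_def)
  have "p * win_prob s P i + (1 - p) * win_prob t P i \<le> p * win_prob s Q i + (1 - p) * win_prob t Q i"
    using Play p by (intro add_mono mult_left_mono) (auto simp: honest_tournament_def)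
  \<comment> \<open>In a match between \<open>i\<close> and \<open>j\<close> both factors are
    nonnegative if \<open>i\<close> is listed first and nonpositive if second; in any other match
    \<open>q = p\<close>.\<close>
  moreover have "0 \<le> (q - p) * (win_prob s Q i - win_prob t Q i)"
  proof (cases "{a, b} = {i, j}")
    case True
    then consider "a = i" "b = j" | "a = j" "b = i" by (auto simp: doubleton_eq_iff)
    then show ?thesis
    proof cases
      case 1
      then show ?thesis using le H by (simp add: p_def q_def)
    next
      case 2
      then show ?thesis
        using le H game_matricesD(3)[OF assms(3), of i j] game_matricesD(3)[OF assms(4), of i j]
        by (simp add: p_def q_def mult_nonpos_nonpos)
    qed
  next
    case False
    then show ?thesis using eq by (simp add: p_def q_def)
  qed
  ultimately have "p * win_prob s P i + (1 - p) * win_prob t P i \<le> q * win_prob s Q i + (1 - q) * win_prob t Q i"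
    by (simp add: algebra_simps)
  then show ?case
    using Play.prems assms(3,4) by (simp add: win_prob_Play p_def q_def del: specialization.simps)
next
  case (Randomize M k)
  note W = win_prob_Randomize[OF Randomize.prems(1)]
  have "honest_tournament (k \<omega>)" if "\<omega> \<in> space M" for \<omega>
    using Randomize.prems(2) that unfolding honest_tournament_def states.simps by blast
  then have "win_prob (k \<omega>) P i \<le> win_prob (k \<omega>) Q i" if "\<omega> \<in> space M" for \<omega>
    using Randomize.prems(1) that by (intro Randomize.IH) auto
  then show ?case
    unfolding W(1)[OF assms(3)] W(1)[OF assms(4)]
    by (intro integral_mono W(2) assms(3,4))
qed

text \<open>The bound \<open>B\<close> on the number of matches is a Lipschitz constant, since
  \<open>dist P Q\<close> dominates every entry of \<open>P - Q\<close>.\<close>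

lemma tournament_map_win_prob:
  assumes "tournament T"
  shows "tournament_map (\<lambda>P. \<chi> i. win_prob T P i)"
proof -
  obtain B where wf: "well_formed T" and B: "\<forall>S\<in>schedules T. length S \<le> B"
    using assms by (auto simp: tournament_def)
  have "(real B)-lipschitz_on game_matrices (\<lambda>P. win_prob T P i)" for i
  proof (rule lipschitz_onI)
    fix P Q :: "real^'a^'a" assume "P \<in> game_matrices" "Q \<in> game_matrices"
    moreover have "\<bar>P $ k $ l - Q $ k $ l\<bar> \<le> dist P Q" for k l
      using component_le_norm_cart[where x = "P $ k - Q $ k" and i = l] Finite_Cartesian_Product.norm_nth_le[where x = "P - Q" and i = k]
      by (simp add: dist_norm)
    ultimately show "dist (win_prob T P i) (win_prob T Q i) \<le> real B * dist P Q"
      using win_prob_Lipschitz[OF wf _ _ B] by (simp add: dist_real_def)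
  qed simp
  then have "continuous_on game_matrices (\<lambda>P. \<chi> i. win_prob T P i)"
    by (intro continuous_on_vec_lambda lipschitz_on_continuous_on)
  then show ?thesis
    using wf by (auto simp: tournament_map_def probability_vectors_def win_prob_bounds sum_win_prob)
qed

lemma well_formed_state: "S \<in> states T \<Longrightarrow> well_formed T \<Longrightarrow> well_formed S"
  by (induction T) auto

section \<open>Mean values over the results of a fixed schedule\<close>

text \<open>Forgets who won: \<open>map opponents h = map opponents ms\<close> says that the result
  list \<open>h\<close> is compatible with the schedule \<open>ms\<close>.\<close>

abbreviation opponents :: "'n \<times> 'n \<Rightarrow> 'n set" where
  "opponents m \<equiv> {fst m, snd m}"

text \<open>Expectation of \<open>g\<close> over the random result list of the schedule, by a
  recursion that avoids measures. A pair in \<open>ms\<close> is a scheduled match, a pair in the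
  argument of \<open>g\<close> is a result with the winner first.\<close>

primrec mean :: "('n::finite \<times> 'n) list \<Rightarrow> real^'n^'n \<Rightarrow> (('n \<times> 'n) list \<Rightarrow> real) \<Rightarrow> real" where
  "mean [] P g = g []"
| "mean (m # ms) P g = P $ fst m $ snd m * mean ms P (\<lambda>h. g (m # h)) +
     (1 - P $ fst m $ snd m) * mean ms P (\<lambda>h. g ((snd m, fst m) # h))"

text \<open>Only result lists compatible with the schedule contribute to a mean. This matters since
  \<open>f\<close> is controlled only at their empirical matrices.\<close>

lemma mean_cong:
  assumes "\<And>h. map opponents h = map opponents ms \<Longrightarrow> g h = g' h"
  shows "mean ms P g = mean ms P g'"
  using assms
proof (induction ms arbitrary: g g')
  case (Cons m ms)
  have "mean ms P (\<lambda>h. g (m # h)) = mean ms P (\<lambda>h. g' (m # h))"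
    "mean ms P (\<lambda>h. g ((snd m, fst m) # h)) = mean ms P (\<lambda>h. g' ((snd m, fst m) # h))"
    by (rule Cons.IH; rule Cons.prems; auto)+
  then show ?case by simp
qed simp

lemma mean_mono:
  assumes "P \<in> game_matrices" "\<And>h. map opponents h = map opponents ms \<Longrightarrow> g h \<le> g' h"
  shows "mean ms P g \<le> mean ms P g'"
  using assms(2)
proof (induction ms arbitrary: g g')
  case (Cons m ms)
  have "mean ms P (\<lambda>h. g (m # h)) \<le> mean ms P (\<lambda>h. g' (m # h))"
    "mean ms P (\<lambda>h. g ((snd m, fst m) # h)) \<le> mean ms P (\<lambda>h. g' ((snd m, fst m) # h))"
    by (rule Cons.IH; rule Cons.prems; auto)+
  then show ?case
    using game_matricesD(1,2)[OF assms(1), of "fst m" "snd m"]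
    unfolding mean.simps by (intro add_mono mult_left_mono) simp_all
qed simp

lemma mean_const [simp]: "mean ms P (\<lambda>h. a) = a"
  by (induction ms) (auto simp: algebra_simps)

lemma mean_add: "mean ms P (\<lambda>h. g h + g' h) = mean ms P g + mean ms P g'"
  by (induction ms arbitrary: g g') (auto simp: algebra_simps)

lemma mean_cmult: "mean ms P (\<lambda>h. a * g h) = a * mean ms P g"
  by (induction ms arbitrary: g) (auto simp: algebra_simps)

lemma mean_sum: "mean ms P (\<lambda>h. \<Sum>x\<in>A. g x h) = (\<Sum>x\<in>A. mean ms P (g x))"
  by (induction A rule: infinite_finite_induct) (auto simp: mean_add)

lemma abs_mean_diff_le:
  assumes "P \<in> game_matrices" "\<And>h. map opponents h = map opponents ms \<Longrightarrow> \<bar>g h - a\<bar> \<le> b h"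
  shows "\<bar>mean ms P g - a\<bar> \<le> mean ms P b"
proof -
  have "mean ms P g \<le> mean ms P (\<lambda>h. a + b h)" "mean ms P (\<lambda>h. a + -1 * b h) \<le> mean ms P g"
    using assms(2) by (intro mean_mono[OF assms(1)]; fastforce simp: abs_le_iff)+
  then show ?thesis
    unfolding mean_add mean_cmult by simp
qed

section \<open>Invariance of means under reordering and relabelling\<close>

text \<open>Listing the two players in the other order swaps the two summands, as their weights are
  complementary.\<close>

lemma mean_flip:
  assumes "P \<in> game_matrices" "opponents m = opponents m'"
  shows "mean (m # ms) P g = mean (m' # ms) P g"
proof -
  have "m' = m \<or> m' = (snd m, fst m)"
    using assms(2) by (cases m; cases m') (auto simp: doubleton_eq_iff)
  then show ?thesis
    using game_matricesD(3)[OF assms(1), of "snd m" "fst m"] by auto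
qed

text \<open>Adjacent independent matches commute under a statistic that ignores order; repeated
  swaps bring \<open>m\<close> to the front.\<close>

lemma mean_move:
  assumes "\<And>h h'. mset h = mset h' \<Longrightarrow> g h = g h'"
  shows "mean (xs @ m # ys) P g = mean (m # xs @ ys) P g"
  using assms
proof (induction xs arbitrary: g)
  case (Cons x xs)
  have IH: "mean (xs @ m # ys) P (\<lambda>h. g (z # h)) = mean (m # xs @ ys) P (\<lambda>h. g (z # h))" for z
    by (rule Cons.IH) (auto intro: Cons.prems)
  have *: "g (a # b # h) = g (b # a # h)" for a b h
    by (rule Cons.prems) simp
  show ?case
    by (simp add: IH *[of x] *[of "(snd x, fst x)"] algebra_simps)
qed simp

text \<open>Lets symmetry survive an asymmetric order of play. The first match of \<open>ms\<close>
  is located in \<open>ms'\<close>, oriented by \<open>mean_flip\<close> and brought to the front by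
  \<open>mean_move\<close>; induction handles the rest.\<close>

lemma mean_permute:
  assumes "P \<in> game_matrices" "mset (map opponents ms) = mset (map opponents ms')"
    and "\<And>h h'. mset h = mset h' \<Longrightarrow> g h = g h'"
  shows "mean ms P g = mean ms' P g"
  using assms(2,3)
proof (induction ms arbitrary: ms' g)
  case (Cons m ms)
  have "opponents m \<in> set (map opponents ms')"
    unfolding mset_eq_setD[OF Cons.prems(1), symmetric] by simp
  then obtain m' where m': "m' \<in> set ms'" "opponents m = opponents m'" by auto
  then obtain xs ys where ms': "ms' = xs @ m' # ys" by (meson split_list)
  have "mset (map opponents ms) = mset (map opponents (xs @ ys))"
    using Cons.prems(1) m'(2) by (simp add: ms')
  then have "mean ms P (\<lambda>h. g (z # h)) = mean (xs @ ys) P (\<lambda>h. g (z # h))" for z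
    by (rule Cons.IH) (auto intro: Cons.prems(2))
  then have "mean (m # ms) P g = mean (m # xs @ ys) P g" by simp
  also have "\<dots> = mean (m' # xs @ ys) P g"
    by (rule mean_flip[OF assms(1) m'(2)])
  also have "\<dots> = mean ms' P g"
    unfolding ms' by (rule mean_move[symmetric]) (rule Cons.prems(2))
  finally show ?case .
next
  case Nil
  have "ms' = []" using Nil.prems(1) by simp
  then show ?case by simp
qed

lemma mean_relabel:
  assumes "\<And>i j. Q $ \<sigma> i $ \<sigma> j = P $ i $ j"
  shows "mean (map (map_prod \<sigma> \<sigma>) ms) Q g = mean ms P (\<lambda>h. g (map (map_prod \<sigma> \<sigma>) h))"
  by (induction ms arbitrary: g) (auto simp: assms map_prod_def case_prod_unfold)

text \<open>The deviation of the number of wins from its mean is a martingale, and each match between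
  \<open>k\<close> and \<open>l\<close> contributes at most 1 to its variance.\<close>

lemma mean_deviation_squared_le:
  assumes "P \<in> game_matrices" "k \<noteq> l"
  shows "mean ms P (\<lambda>h. (a + (real (count_list h (k, l)) - P $ k $ l * real (count_list (map opponents h) {k, l})))\<^sup>2)
     \<le> a\<^sup>2 + real (count_list (map opponents ms) {k, l})"
proof (induction ms arbitrary: a)
  case (Cons m ms)
  define p where "p = P $ k $ l"
  have p: "0 \<le> p" "p \<le> 1" using game_matricesD(1,2)[OF assms(1)] by (auto simp: p_def)
  define D where "D h = real (count_list h (k, l)) - p * real (count_list (map opponents h) {k, l})" for h
  define c where "c = real (count_list (map opponents ms) {k, l})"
  \<comment> \<open>The free offset \<open>a\<close> stands for the deviation accumulated in earlier
    matches.\<close>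
  have IH: "mean ms P (\<lambda>h. (a + D h)\<^sup>2) \<le> a\<^sup>2 + c" for a
    using Cons.IH by (simp add: D_def p_def c_def)
  have D: "D ((k, l) # h) = (1 - p) + D h" "D ((l, k) # h) = - p + D h" for h
    using assms(2) by (auto simp: D_def algebra_simps insert_commute)
  have D': "D (m' # h) = D h" if "opponents m' \<noteq> {k, l}" for m' h
    using that by (auto simp: D_def)
  have "mean (m # ms) P (\<lambda>h. (a + D h)\<^sup>2) \<le> a\<^sup>2 + real (count_list (map opponents (m # ms)) {k, l})"
  proof (cases "opponents m = {k, l}")
    case True
    have "mean (m # ms) P (\<lambda>h. (a + D h)\<^sup>2) = mean ((k, l) # ms) P (\<lambda>h. (a + D h)\<^sup>2)"
      using True by (intro mean_flip[OF assms(1)]) simp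
    also have "\<dots> = p * mean ms P (\<lambda>h. (a + (1 - p) + D h)\<^sup>2) + (1 - p) * mean ms P (\<lambda>h. (a + - p + D h)\<^sup>2)"
      by (simp only: mean.simps fst_conv snd_conv D p_def[symmetric] add.assoc)
    also have "\<dots> \<le> p * ((a + (1 - p))\<^sup>2 + c) + (1 - p) * ((a + - p)\<^sup>2 + c)"
      using p by (intro add_mono mult_left_mono IH) auto
    \<comment> \<open>The increment, \<open>1 - p\<close> with probability \<open>p\<close> and
      \<open>- p\<close> otherwise, has mean zero: the terms linear in \<open>a\<close> cancel and
      its variance \<open>p * (1 - p)\<close> remains.\<close>
    also have "\<dots> = a\<^sup>2 + p * (1 - p) + c"
      by (simp add: power2_eq_square algebra_simps)
    also have "\<dots> \<le> a\<^sup>2 + 1 + c"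
      using p mult_mono[of p 1 "1 - p" 1] by simp
    finally show ?thesis using True by (simp add: c_def)
  next
    case False
    then show ?thesis
      using IH[of a] D'[of m] D'[of "(snd m, fst m)"]
      by (simp add: c_def insert_commute algebra_simps)
  qed
  then show ?case by (simp only: D_def p_def)
qed simp

section \<open>Trees that play a fixed schedule, and the final lottery\<close>

lemma well_formed_play_all:
  assumes "\<forall>m\<in>set ms. fst m \<noteq> snd m" "\<And>h. map opponents h = map opponents ms \<Longrightarrow> well_formed (c h)"
  shows "well_formed (play_all ms c)"
  using assms
proof (induction ms arbitrary: c)
  case (Cons m ms)
  have "well_formed (play_all ms (\<lambda>h. c (m # h)))" "well_formed (play_all ms (\<lambda>h. c ((snd m, fst m) # h)))"
    by (rule Cons.IH; (rule Cons.prems)?; use Cons.prems(1) in auto)+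
  then show ?case using Cons.prems(1) by simp
qed simp

lemma schedules_play_all:
  assumes "\<And>h. schedules (c h) = {[]}"
  shows "schedules (play_all ms c) = {map opponents ms}"
  using assms by (induction ms arbitrary: c) auto

text \<open>The bridge from the measure to \<open>mean\<close>, by iterating the one-match formula;
  the event must vary in the induction because each result is prepended to the history.\<close>

lemma measure_specialization_play_all:
  assumes "well_formed (play_all ms c)" "P \<in> game_matrices"
  shows "measure (specialization (play_all ms c) P) A =
     mean ms P (\<lambda>h. measure (specialization (c h) P) {(h', w). (h @ h', w) \<in> A})"
  using assms(1)
proof (induction ms arbitrary: c A)
  case (Cons m ms)
  note IH = Cons.IH[where A = "{(h, w). (z # h, w) \<in> A}" for z]
  show ?case
    using Cons.prems measure_specialization_Play[OF Cons.prems[unfolded play_all.simps] assms(2), of A]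
    by (simp add: IH del: specialization.simps)
qed simp

text \<open>Both subtrees at a match play the same \<open>rest\<close> and differ only in the
  recorded current result, so the two sides of honesty become means over one schedule.\<close>

lemma Play_in_states_play_all:
  assumes "Play i j s t \<in> states (play_all ms c)" "\<And>h a b u v. Play a b u v \<notin> states (c h)"
  obtains past rest where "map opponents (past @ (i, j) # rest) = map opponents ms"
    "s = play_all rest (\<lambda>h. c (past @ (i, j) # h))" "t = play_all rest (\<lambda>h. c (past @ (j, i) # h))"
proof -
  have "\<exists>past rest. map opponents (past @ (i, j) # rest) = map opponents ms \<and>
    s = play_all rest (\<lambda>h. c (past @ (i, j) # h)) \<and> t = play_all rest (\<lambda>h. c (past @ (j, i) # h))"
    using assms
  proof (induction ms arbitrary: c)
    case (Cons m ms)
    from Cons.prems(1) consider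
        "i = fst m" "j = snd m" "s = play_all ms (\<lambda>h. c (m # h))" "t = play_all ms (\<lambda>h. c ((snd m, fst m) # h))"
      | "Play i j s t \<in> states (play_all ms (\<lambda>h. c (m # h)))"
      | "Play i j s t \<in> states (play_all ms (\<lambda>h. c ((snd m, fst m) # h)))"
      by auto
    then show ?case
    proof cases
      case 1
      then show ?thesis by (intro exI[of _ "[]"] exI[of _ ms]) simp
    next
      case 2
      from Cons.IH[OF this] Cons.prems(2) obtain past rest where
        "map opponents (past @ (i, j) # rest) = map opponents ms"
        "s = play_all rest (\<lambda>h. c (m # past @ (i, j) # h))"
        "t = play_all rest (\<lambda>h. c (m # past @ (j, i) # h))" by auto
      then show ?thesis by (intro exI[of _ "m # past"] exI[of _ rest]) simp
    next
      case 3
      from Cons.IH[OF this] Cons.prems(2) obtain past rest where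
        "map opponents (past @ (i, j) # rest) = map opponents ms"
        "s = play_all rest (\<lambda>h. c ((snd m, fst m) # past @ (i, j) # h))"
        "t = play_all rest (\<lambda>h. c ((snd m, fst m) # past @ (j, i) # h))" by auto
      then show ?thesis by (intro exI[of _ "(snd m, fst m) # past"] exI[of _ rest]) auto
    qed
  qed auto
  then show ?thesis using that by blast
qed

definition lottery :: "real^'n \<Rightarrow> ('n::finite, 'n) rules" where
  "lottery x = Randomize (point_measure UNIV (\<lambda>i. ennreal (x $ i))) Winner"

lemma schedules_lottery [simp]: "schedules (lottery x) = {[]}"
  by (simp add: lottery_def space_point_measure)

lemma Play_notin_states_lottery [simp]: "Play i j s t \<notin> states (lottery x)"
  by (simp add: lottery_def)

lemma well_formed_lottery:
  assumes "x \<in> probability_vectors"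
  shows "well_formed (lottery x)"
proof -
  have "prob_space (point_measure UNIV (\<lambda>i. ennreal (x $ i)))"
    using assms
    by (intro prob_spaceI) (simp add: space_point_measure emeasure_point_measure_finite probability_vectors_def)
  then show ?thesis
    by (auto simp: lottery_def space_prob_algebra intro!: prob_space_return)
qed

lemma measure_specialization_lottery:
  assumes "x \<in> probability_vectors" "P \<in> game_matrices"
  shows "measure (specialization (lottery x) P) A = (\<Sum>w\<in>UNIV. x $ w * indicator A ([], w))"
  using measure_specialization_Randomize(1)[OF well_formed_lottery[OF assms(1), unfolded lottery_def] assms(2), of A] assms(1)
  by (simp add: lottery_def lebesgue_integral_point_measure_finite probability_vectors_def measure_return)


section \<open>Tournaments decided by the empirical matrix\<close>

text \<open>What is retained of \<open>N\<close> round-robins, regardless of order of play; this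
  property is stable under relabelling the players.\<close>

definition regular_schedule :: "nat \<Rightarrow> ('n \<times> 'n) list \<Rightarrow> bool" where
  "regular_schedule N ms \<longleftrightarrow> (\<forall>m\<in>set ms. fst m \<noteq> snd m) \<and>
     (\<forall>i j. i \<noteq> j \<longrightarrow> count_list (map opponents ms) {i, j} = N)"

lemma regular_schedule_round_robins:
  assumes "round_robin ps"
  shows "regular_schedule N (concat (replicate N ps))"
proof -
  have "count_list (map opponents (concat (replicate N ps))) {i, j} = N" if "i \<noteq> j" for i j
    using assms that by (induction N) (auto simp: round_robin_def case_prod_unfold)
  then show ?thesis
    using assms by (fastforce simp: regular_schedule_def round_robin_def)
qed

lemma regular_schedule_map:
  assumes "bij \<sigma>" "regular_schedule N ms"
  shows "regular_schedule N (map (map_prod \<sigma> \<sigma>) ms)"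
proof -
  have inj: "inj \<sigma>" using assms(1) by (rule bij_is_inj)
  have count: "count_list (map opponents (map (map_prod \<sigma> \<sigma>) ms)) {\<sigma> i, \<sigma> j} = count_list (map opponents ms) {i, j}" for i j
    by (induction ms) (auto simp: doubleton_eq_iff inj_eq[OF inj])
  have "count_list (map opponents (map (map_prod \<sigma> \<sigma>) ms)) {i, j} = N" if "i \<noteq> j" for i j
  proof -
    obtain i' j' where "i = \<sigma> i'" "j = \<sigma> j'"
      using assms(1) by (meson bij_pointE)
    moreover from this that have "i' \<noteq> j'" by blast
    ultimately show ?thesis
      using assms(2) count[of i' j'] by (simp add: regular_schedule_def del: map_map)
  qed
  moreover have "\<forall>m\<in>set (map (map_prod \<sigma> \<sigma>) ms). fst m \<noteq> snd m"
    using assms(2) by (auto simp: regular_schedule_def inj_eq[OF inj])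
  ultimately show ?thesis
    unfolding regular_schedule_def by blast
qed

text \<open>Makes \<open>mean_permute\<close> applicable to a schedule and its relabelling.
  Two-element sets occur \<open>N\<close> times in both lists, all other sets never, as no player
  meets himself.\<close>

lemma mset_opponents_regular_schedule:
  assumes "regular_schedule N ms" "regular_schedule N ms'"
  shows "mset (map opponents ms) = mset (map opponents ms')"
proof (rule multiset_eqI)
  fix e
  show "count (mset (map opponents ms)) e = count (mset (map opponents ms')) e"
  proof (cases "\<exists>i j. i \<noteq> j \<and> e = {i, j}")
    case True
    then show ?thesis using assms by (auto simp: regular_schedule_def count_mset simp del: mset_map)
  next
    case False
    then have "opponents m \<noteq> e" if "fst m \<noteq> snd m" for m
      using that by blast
    then have "e \<notin> set (map opponents ms)" "e \<notin> set (map opponents ms')"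
      using assms unfolding regular_schedule_def set_map by blast+
    then show ?thesis by (simp only: count_mset count_notin not_False_eq_True)
  qed
qed

lemma count_list_opponents:
  assumes "i \<noteq> j"
  shows "count_list (map opponents h) {i, j} = count_list h (i, j) + count_list h (j, i)"
  using assms by (induction h) (auto simp: doubleton_eq_iff prod_eq_iff)

lemma empirical_matrix_cong:
  "mset h = mset h' \<Longrightarrow> empirical_matrix N h = empirical_matrix N h'"
  by (simp add: empirical_matrix_def vec_eq_iff flip: count_mset)

section \<open>The tournament attached to a map and a schedule\<close>

text \<open>Any regular schedule is allowed, so that the symmetry proof can instantiate the locale a
  second time with the relabelled one.\<close>

locale empirical_tournament =
  fixes f :: "real^'n^'n \<Rightarrow> real^'n::finite" and N :: nat and ms :: "('n \<times> 'n) list"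
  assumes tm: "tournament_map f" and N: "N > 0" and reg: "regular_schedule N ms"
begin

definition rules where
  "rules = play_all ms (\<lambda>h. lottery (f (empirical_matrix N h)))"

lemma empirical_matrix_in_game_matrices:
  assumes "map opponents h = map opponents ms"
  shows "empirical_matrix N h \<in> game_matrices"
proof (rule game_matricesI)
  fix i j
  show "0 \<le> empirical_matrix N h $ i $ j" by (simp add: empirical_matrix_def)
  show "empirical_matrix N h $ i $ j + empirical_matrix N h $ j $ i = 1"
  proof (cases "i = j")
    case False
    then have "count_list h (i, j) + count_list h (j, i) = N"
      using reg by (simp add: regular_schedule_def assms flip: count_list_opponents)
    then have "real (count_list h (i, j)) + real (count_list h (j, i)) = real N"
      by linarith
    then show ?thesis using False N by (simp add: empirical_matrix_def flip: add_divide_distrib)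
  qed (simp add: empirical_matrix_def)
qed

lemma f_empirical:
  "map opponents h = map opponents ms \<Longrightarrow> f (empirical_matrix N h) \<in> probability_vectors"
  using tm empirical_matrix_in_game_matrices by (auto simp: tournament_map_def)

lemma well_formed_rules: "well_formed rules"
  using reg unfolding rules_def
  by (intro well_formed_play_all well_formed_lottery f_empirical) (auto simp: regular_schedule_def)

lemma schedules_rules: "schedules rules = {map opponents ms}"
  unfolding rules_def by (rule schedules_play_all) simp

lemma tournament_rules: "tournament rules"
  by (auto simp: tournament_def well_formed_rules schedules_rules)

lemma fixed_schedule_rules: "fixed_schedule rules"
  by (simp add: fixed_schedule_def schedules_rules)

lemma equal_meetings_rules: "equal_meetings rules"
  using reg by (auto simp: equal_meetings_def schedules_rules regular_schedule_def)

text \<open>Treats a state with results \<open>past\<close> already fixed: the empty list gives the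
  whole tournament, longer lists the subtrees in the honesty proof.\<close>

lemma win_prob_continuation:
  assumes "well_formed (play_all rest (\<lambda>h. lottery (f (empirical_matrix N (past @ h)))))"
    and "map opponents (past @ rest) = map opponents ms" "P \<in> game_matrices"
  shows "win_prob (play_all rest (\<lambda>h. lottery (f (empirical_matrix N (past @ h))))) P i =
    mean rest P (\<lambda>h. f (empirical_matrix N (past @ h)) $ i)"
  unfolding win_prob_eq[OF assms(1,3)] measure_specialization_play_all[OF assms(1,3)]
proof (rule mean_cong)
  fix h assume "map opponents h = map opponents rest"
  with assms(2) have "f (empirical_matrix N (past @ h)) \<in> probability_vectors"
    by (intro f_empirical) simp
  then show "measure (specialization (lottery (f (empirical_matrix N (past @ h)))) P)
      {(h', w). (h @ h', w) \<in> {(h, w). w = i}} = f (empirical_matrix N (past @ h)) $ i"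
    using assms(3) by (simp add: measure_specialization_lottery indicator_def)
qed

lemma win_prob_rules:
  "P \<in> game_matrices \<Longrightarrow> win_prob rules P i = mean ms P (\<lambda>h. f (empirical_matrix N h) $ i)"
  using win_prob_continuation[of ms "[]"] well_formed_rules by (simp add: rules_def)

text \<open>Symmetry of \<open>f\<close> relabels the results inside the mean,
  \<open>mean_relabel\<close> passes to the relabelled schedule and to \<open>Q\<close>, and
  \<open>mean_permute\<close> returns to the original schedule.\<close>

lemma symmetric_rules:
  assumes "symmetric_map f"
  shows "symmetric_tournament rules"
  unfolding symmetric_tournament_def
proof (intro ballI allI impI)
  fix P Q :: "real^'n^'n" and \<sigma> :: "'n \<Rightarrow> 'n" and i
  assume PQ: "P \<in> game_matrices" "Q \<in> game_matrices" and \<sigma>: "bij \<sigma>"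
    and eq: "\<forall>i j. Q $ \<sigma> i $ \<sigma> j = P $ i $ j"
  have inj: "inj \<sigma>" using \<sigma> by (rule bij_is_inj)
  let ?\<sigma> = "map (map_prod \<sigma> \<sigma>)"
  have cnt: "count_list (?\<sigma> h) (\<sigma> k, \<sigma> l) = count_list h (k, l)" for h k l
    by (induction h) (auto simp: inj_eq[OF inj])
  have "win_prob rules P i = mean ms P (\<lambda>h. f (empirical_matrix N (?\<sigma> h)) $ \<sigma> i)"
    unfolding win_prob_rules[OF PQ(1)]
  proof (rule mean_cong)
    fix h assume h: "map opponents h = map opponents ms"
    interpret s: empirical_tournament f N "?\<sigma> ms"
      using tm N reg \<sigma> by unfold_locales (auto intro: regular_schedule_map)
    have "map opponents (?\<sigma> h) = map opponents (?\<sigma> ms)"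
    proof -
      have "map opponents (?\<sigma> h') = map ((`) \<sigma>) (map opponents h')" for h' by simp
      then show ?thesis by (simp only: h)
    qed
    then show "f (empirical_matrix N h) $ i = f (empirical_matrix N (?\<sigma> h)) $ \<sigma> i"
      using assms \<sigma> empirical_matrix_in_game_matrices[OF h] s.empirical_matrix_in_game_matrices
      unfolding symmetric_map_def
      by (elim ballE allE impE) (auto simp: empirical_matrix_def cnt inj_eq[OF inj])
  qed
  also have "\<dots> = mean (?\<sigma> ms) Q (\<lambda>h. f (empirical_matrix N h) $ \<sigma> i)"
    using eq by (subst mean_relabel[of Q \<sigma> P]) auto
  also have "\<dots> = mean ms Q (\<lambda>h. f (empirical_matrix N h) $ \<sigma> i)"
  proof (rule mean_permute[OF PQ(2)])
    show "mset (map opponents (?\<sigma> ms)) = mset (map opponents ms)"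
      by (rule mset_opponents_regular_schedule[OF regular_schedule_map[OF \<sigma> reg] reg])
    show "f (empirical_matrix N h) $ \<sigma> i = f (empirical_matrix N h') $ \<sigma> i" if "mset h = mset h'" for h h'
      by (simp only: empirical_matrix_cong[OF that])
  qed
  also have "\<dots> = win_prob rules Q (\<sigma> i)"
    using PQ by (simp add: win_prob_rules)
  finally show "win_prob rules P i = win_prob rules Q (\<sigma> i)" .
qed

section \<open>Honesty and strong honesty\<close>

text \<open>Reversing one result changes only the two entries of the empirical matrix that belong to
  this pair, exactly the comparison made in \<open>honest_map\<close>.\<close>

lemma winning_helps:
  assumes "honest_map f" "i \<noteq> j" "map opponents (past @ (i, j) # future) = map opponents ms"
  shows "f (empirical_matrix N (past @ (j, i) # future)) $ i \<le> f (empirical_matrix N (past @ (i, j) # future)) $ i"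
proof -
  have "map opponents (past @ (j, i) # future) = map opponents ms"
    using assms(3) by (simp add: insert_commute)
  note G = this[THEN empirical_matrix_in_game_matrices] assms(3)[THEN empirical_matrix_in_game_matrices]
  have "empirical_matrix N (past @ (i, j) # future) $ k $ l = empirical_matrix N (past @ (j, i) # future) $ k $ l"
    if "{k, l} \<noteq> {i, j}" for k l
  proof -
    have neq: "(i, j) \<noteq> (k, l)" "(j, i) \<noteq> (k, l)"
      using that by (auto simp: doubleton_eq_iff)
    have "count_list (past @ (i, j) # future) (k, l) = count_list (past @ (j, i) # future) (k, l)"
      unfolding count_list_append count_list.simps if_not_P[OF neq(1)] if_not_P[OF neq(2)] ..
    then show ?thesis by (simp only: empirical_matrix_def vec_lambda_beta)
  qed
  moreover have "empirical_matrix N (past @ (j, i) # future) $ i $ j \<le> empirical_matrix N (past @ (i, j) # future) $ i $ j"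
    using assms(2) by (simp add: empirical_matrix_def divide_right_mono)
  ultimately show ?thesis
    using assms(1,2) G unfolding honest_map_def by blast
qed

text \<open>\<open>winning_helps\<close> is averaged over the remaining matches; exchanging the
  players gives the inequality for \<open>j\<close>.\<close>

lemma honest_rules:
  assumes "honest_map f"
  shows "honest_tournament rules"
  unfolding honest_tournament_def
proof (intro allI impI ballI)
  fix i j s t and P :: "real^'n^'n"
  assume st: "Play i j s t \<in> states rules" and P: "P \<in> game_matrices"
  then have wf: "i \<noteq> j" "well_formed s" "well_formed t"
    using well_formed_state[OF st well_formed_rules] by auto
  from st obtain past rest where eq: "map opponents (past @ (i, j) # rest) = map opponents ms"
    and s: "s = play_all rest (\<lambda>h. lottery (f (empirical_matrix N ((past @ [(i, j)]) @ h))))"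
    and t: "t = play_all rest (\<lambda>h. lottery (f (empirical_matrix N ((past @ [(j, i)]) @ h))))"
    unfolding rules_def by (elim Play_in_states_play_all) auto
  have W: "win_prob s P k = mean rest P (\<lambda>h. f (empirical_matrix N (past @ (i, j) # h)) $ k)"
    "win_prob t P k = mean rest P (\<lambda>h. f (empirical_matrix N (past @ (j, i) # h)) $ k)" for k
    using win_prob_continuation[OF wf(2)[unfolded s] _ P] win_prob_continuation[OF wf(3)[unfolded t] _ P] eq
    by (simp_all add: s t insert_commute)
  show "win_prob t P i \<le> win_prob s P i \<and> win_prob s P j \<le> win_prob t P j"
    unfolding W using eq wf(1)
    by (intro conjI mean_mono[OF P] winning_helps[OF assms]) (auto simp: insert_commute)
qed

text \<open>The last factor is the probability of the history, the first that of the draw given it.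
  \<open>W\<close> is later \<open>UNIV\<close> for the condition and a singleton for the joint
  event.\<close>

lemma prob_history:
  assumes "P \<in> game_matrices"
  shows "measure (specialization rules P) {x. fst x = h \<and> snd x \<in> W} =
     (\<Sum>w\<in>W. f (empirical_matrix N h) $ w) * mean ms P (\<lambda>h'. if h' = h then 1 else 0)"
  unfolding rules_def measure_specialization_play_all[OF well_formed_rules[unfolded rules_def] assms]
    mean_cmult[symmetric]
proof (rule mean_cong)
  fix h' assume "map opponents h' = map opponents ms"
  then have "f (empirical_matrix N h') \<in> probability_vectors" by (rule f_empirical)
  then show "measure (specialization (lottery (f (empirical_matrix N h'))) P)
      {(h'', w). (h' @ h'', w) \<in> {x. fst x = h \<and> snd x \<in> W}} =
    (\<Sum>w\<in>W. f (empirical_matrix N h) $ w) * (if h' = h then 1 else 0)"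
    using assms by (simp add: measure_specialization_lottery indicator_def sum.If_cases)
qed

lemma cond_prob_history:
  assumes "P \<in> game_matrices" "\<P>(x in specialization rules P. fst x = h) > 0"
  shows "map opponents h = map opponents ms"
    and "\<P>(x in specialization rules P. snd x = i \<bar> fst x = h) = f (empirical_matrix N h) $ i"
proof -
  define c where "c = mean ms P (\<lambda>h'. if h' = h then 1 else 0)"
  note [simp] = prob_space_specialization(3)[OF well_formed_rules assms(1)]
  have U: "\<P>(x in specialization rules P. fst x = h) = (\<Sum>w\<in>UNIV. f (empirical_matrix N h) $ w) * c"
    using prob_history[OF assms(1), of h UNIV] by (simp add: c_def)
  \<comment> \<open>Compatibility comes first: it makes \<open>f\<close> at the empirical matrix a
    probability vector, so the condition has probability \<open>c\<close>, which then
    cancels.\<close>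
  show h: "map opponents h = map opponents ms"
  proof (rule ccontr)
    assume "map opponents h \<noteq> map opponents ms"
    then have "c = mean ms P (\<lambda>_. 0)"
      unfolding c_def by (intro mean_cong) auto
    then show False using assms(2) U by simp
  qed
  have "(\<Sum>w\<in>UNIV. f (empirical_matrix N h) $ w) = 1"
    using f_empirical[OF h] by (simp add: probability_vectors_def)
  then show "\<P>(x in specialization rules P. snd x = i \<bar> fst x = h) = f (empirical_matrix N h) $ i"
    using prob_history[OF assms(1), of h "{i}"] assms(2) U
    by (simp add: cond_prob_def c_def conj_commute)
qed

lemma strongly_honest_rules:
  assumes "honest_map f"
  shows "strongly_honest rules"
  unfolding strongly_honest_def
proof (intro ballI allI impI)
  fix P :: "real^'n^'n" and i j past future
  assume P: "P \<in> game_matrices"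
    and pos: "\<P>(x in specialization rules P. fst x = past @ [(i, j)] @ future) > 0"
      "\<P>(x in specialization rules P. fst x = past @ [(j, i)] @ future) > 0"
  show "\<P>(x in specialization rules P. snd x = i \<bar> fst x = past @ [(i, j)] @ future)
    \<ge> \<P>(x in specialization rules P. snd x = i \<bar> fst x = past @ [(j, i)] @ future)"
  proof (cases "i = j")
    case False
    then show ?thesis
      using winning_helps[OF assms False] cond_prob_history[OF P pos(1)] cond_prob_history[OF P pos(2)]
      by simp
  qed simp
qed

section \<open>Concentration of the empirical matrix\<close>

text \<open>Chebyshev's bound in the form \<open>\<bar>x\<bar> \<le> x\<^sup>2 / (2 \<delta>) + \<delta> / 2\<close>, which avoids square roots.\<close>

lemma mean_empirical_error_le:
  fixes \<delta> :: real
  assumes "P \<in> game_matrices" "\<delta> > 0"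
  shows "mean ms P (\<lambda>h. \<bar>empirical_matrix N h $ k $ l - P $ k $ l\<bar>) \<le> 1 / (2 * \<delta> * N) + \<delta> / 2"
proof (cases "k = l")
  case True
  then have "P $ k $ l = 1 / 2" using game_matricesD(3)[OF assms(1), of k k] by simp
  moreover have "0 \<le> 1 / (2 * \<delta> * N) + \<delta> / 2" using assms(2) by simp
  ultimately show ?thesis using True by (simp add: empirical_matrix_def)
next
  case False
  define D where "D h = real (count_list h (k, l)) - P $ k $ l * real (count_list (map opponents h) {k, l})" for h
  have count: "count_list (map opponents ms) {k, l} = N"
    using reg False by (simp add: regular_schedule_def)
  have "mean ms P (\<lambda>h. \<bar>empirical_matrix N h $ k $ l - P $ k $ l\<bar>)
      \<le> mean ms P (\<lambda>h. 1 / (2 * \<delta> * (real N)\<^sup>2) * (D h)\<^sup>2 + \<delta> / 2)"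
  proof (rule mean_mono[OF assms(1)])
    fix h assume h: "map opponents h = map opponents ms"
    define x where "x = empirical_matrix N h $ k $ l - P $ k $ l"
    \<comment> \<open>Every compatible result list contains exactly \<open>N\<close> meetings of the
      pair.\<close>
    have "D h = x * N"
      using False N by (simp add: D_def x_def empirical_matrix_def h count field_simps)
    moreover have "0 \<le> (\<bar>x\<bar> - \<delta>)\<^sup>2" by simp
    then have "\<bar>x\<bar> \<le> x\<^sup>2 / (2 * \<delta>) + \<delta> / 2"
      using assms(2) by (simp add: power2_diff field_simps power2_eq_square)
    ultimately show "\<bar>empirical_matrix N h $ k $ l - P $ k $ l\<bar> \<le> 1 / (2 * \<delta> * (real N)\<^sup>2) * (D h)\<^sup>2 + \<delta> / 2"
      using N by (simp add: x_def power_mult_distrib)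
  qed
  also have "\<dots> = 1 / (2 * \<delta> * (real N)\<^sup>2) * mean ms P (\<lambda>h. (D h)\<^sup>2) + \<delta> / 2"
    by (simp only: mean_add mean_cmult mean_const)
  \<comment> \<open>With offset 0 the second moment is at most the number \<open>N\<close> of
    meetings.\<close>
  also have "\<dots> \<le> 1 / (2 * \<delta> * (real N)\<^sup>2) * N + \<delta> / 2"
    using mean_deviation_squared_le[OF assms(1) False, of ms 0] assms(2)
    by (intro add_right_mono mult_left_mono) (simp_all add: D_def count)
  also have "\<dots> = 1 / (2 * \<delta> * N) + \<delta> / 2"
    using N by (simp add: power2_eq_square)
  finally show ?thesis .
qed

end

section \<open>Closeness and conclusion\<close>

lemma map_tournament_eq_rules:
  assumes "tournament_map f" "N > 0" "round_robin ps"
  shows "empirical_tournament f N (concat (replicate N ps))"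
    and "map_tournament f N ps = empirical_tournament.rules f N (concat (replicate N ps))"
proof -
  show *: "empirical_tournament f N (concat (replicate N ps))"
    using assms by unfold_locales (auto intro: regular_schedule_round_robins)
  show "map_tournament f N ps = empirical_tournament.rules f N (concat (replicate N ps))"
    unfolding empirical_tournament.rules_def[OF *] map_tournament_def lottery_def ..
qed

text \<open>The error bound does not see the order of play, so \<open>N\<close> can be chosen before
  \<open>ps\<close>.\<close>

lemma eps_close_map_tournament:
  fixes T :: "('n::finite, 'r) rules"
  assumes "tournament T" "\<epsilon> > 0"
  obtains N where "N > 0"
    "\<And>ps. round_robin ps \<Longrightarrow> eps_close \<epsilon> T (map_tournament (\<lambda>P. \<chi> i. win_prob T P i) N ps)"
proof -
  obtain B where wf: "well_formed T" and B: "\<forall>S\<in>schedules T. length S \<le> B"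
    using assms by (auto simp: tournament_def)
  define f where "f P = (\<chi> i. win_prob T P i)" for P
  \<comment> \<open>Lipschitz constant times number of matrix entries; the added 1 keeps
    \<open>K\<close> positive when \<open>B = 0\<close>.\<close>
  define K where "K = real B * real (CARD('n)) ^ 2 + 1"
  have K: "K > 0" unfolding K_def by (intro add_nonneg_pos) auto
  \<comment> \<open>With \<open>\<delta> = \<epsilon> / K\<close> the two terms of
    \<open>K * e\<close> are \<open>K\<^sup>2 / (2 * \<epsilon> * N)\<close>, less than
    \<open>\<epsilon> / 2\<close> by this choice, and exactly \<open>\<epsilon> / 2\<close>.\<close>
  obtain N :: nat where N: "real N > (K / \<epsilon>)\<^sup>2" using reals_Archimedean2 by blast
  then have N0: "N > 0" by (metis not_gr0 not_less of_nat_0 zero_le_power2)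
  define \<delta> where "\<delta> = \<epsilon> / K"
  have \<delta>: "\<delta> > 0" using K assms(2) by (simp add: \<delta>_def)
  define e where "e = 1 / (2 * \<delta> * N) + \<delta> / 2"
  have e0: "e > 0" using \<delta> N0 by (simp add: e_def add_pos_pos)
  have "K * e < \<epsilon>"
  proof -
    have "K\<^sup>2 < N * \<epsilon>\<^sup>2" using N assms(2) by (simp add: power_divide field_simps)
    then have "K * (1 / (2 * \<delta> * N)) < \<epsilon> / 2"
      using N0 assms(2) K by (simp add: \<delta>_def field_simps power2_eq_square)
    moreover have "K * (\<delta> / 2) = \<epsilon> / 2" using K by (simp add: \<delta>_def)
    ultimately show ?thesis unfolding e_def by (simp add: distrib_left)
  qed
  have "eps_close \<epsilon> T (map_tournament f N ps)" if ps: "round_robin ps" for ps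
  proof -
    have tm: "tournament_map f"
      unfolding f_def by (rule tournament_map_win_prob[OF assms(1)])
    define ms where "ms = concat (replicate N ps)"
    interpret empirical_tournament f N ms
      unfolding ms_def by (rule map_tournament_eq_rules(1)[OF tm N0 ps])
    show ?thesis
      unfolding map_tournament_eq_rules(2)[OF tm N0 ps] ms_def[symmetric] eps_close_def
    proof (intro allI ballI)
      fix i and P :: "real^'n^'n" assume P: "P \<in> game_matrices"
      \<comment> \<open>A sum rather than a maximum: it still dominates each entry, and
        \<open>mean\<close> commutes with it.\<close>
      define d where "d h = (\<Sum>k\<in>UNIV. \<Sum>l\<in>UNIV. \<bar>empirical_matrix N h $ k $ l - P $ k $ l\<bar>)" for h
      have "\<bar>win_prob rules P i - win_prob T P i\<bar> \<le> mean ms P (\<lambda>h. real B * d h)"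
        unfolding win_prob_rules[OF P]
      proof (rule abs_mean_diff_le[OF P])
        fix h assume h: "map opponents h = map opponents ms"
        have "\<bar>empirical_matrix N h $ k $ l - P $ k $ l\<bar> \<le> d h" for k l
        proof -
          have "\<bar>empirical_matrix N h $ k $ l - P $ k $ l\<bar> \<le> (\<Sum>l\<in>UNIV. \<bar>empirical_matrix N h $ k $ l - P $ k $ l\<bar>)"
            by (rule member_le_sum) auto
          also have "\<dots> \<le> d h"
            unfolding d_def by (rule member_le_sum) (auto intro: sum_nonneg)
          finally show ?thesis .
        qed
        then show "\<bar>f (empirical_matrix N h) $ i - win_prob T P i\<bar> \<le> real B * d h"
          using win_prob_Lipschitz[OF wf empirical_matrix_in_game_matrices[OF h] P B] by (simp add: f_def)
      qed
      also have "\<dots> = real B * (\<Sum>k\<in>UNIV. \<Sum>l\<in>UNIV. mean ms P (\<lambda>h. \<bar>empirical_matrix N h $ k $ l - P $ k $ l\<bar>))"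
        unfolding d_def mean_cmult mean_sum ..
      also have "\<dots> \<le> real B * (\<Sum>k\<in>(UNIV :: 'n set). \<Sum>l\<in>(UNIV :: 'n set). e)"
        unfolding e_def by (intro mult_left_mono sum_mono mean_empirical_error_le P \<delta>) auto
      also have "\<dots> \<le> K * e"
        using e0 by (simp add: K_def power2_eq_square algebra_simps)
      also have "\<dots> < \<epsilon>" by fact
      finally show "\<bar>win_prob T P i - win_prob rules P i\<bar> < \<epsilon>"
        by (simp add: abs_minus_commute)
    qed
  qed
  with N0 show ?thesis using that unfolding f_def by blast
qed

theorem corollary6p4:
  fixes T :: "('n::finite, 'r) rules" and \<epsilon> :: real
  assumes "tournament T" and "symmetric_tournament T" and "honest_tournament T"
    and "\<epsilon> > 0"
  shows "(\<exists>f N. tournament_map f \<and> symmetric_map f \<and> honest_map f \<and> N > 0 \<and>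
            (\<forall>ps. round_robin ps \<longrightarrow>
               tournament (map_tournament f N ps) \<and> eps_close \<epsilon> T (map_tournament f N ps))) \<and>
         (\<exists>T' :: ('n, 'n) rules.
            tournament T' \<and> symmetric_tournament T' \<and> honest_tournament T' \<and> eps_close \<epsilon> T T' \<and>
            fixed_schedule T' \<and> equal_meetings T' \<and> strongly_honest T')"
proof -
  define f where "f P = (\<chi> i. win_prob T P i)" for P
  have tm: "tournament_map f"
    unfolding f_def by (rule tournament_map_win_prob[OF assms(1)])
  have sym: "symmetric_map f"
    using assms(2) by (simp add: symmetric_tournament_def symmetric_map_def f_def)
  have hon: "honest_map f"
    using assms(1,3) by (auto simp: honest_map_def f_def tournament_def intro!: win_prob_mono)
  obtain N where N: "N > 0" and close: "\<And>ps. round_robin ps \<Longrightarrow> eps_close \<epsilon> T (map_tournament f N ps)"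
    using eps_close_map_tournament[OF assms(1,4)] unfolding f_def by blast
  note E = map_tournament_eq_rules[OF tm N]
  \<comment> \<open>Any single order of play yields the witness for the second claim.\<close>
  obtain ps :: "('n \<times> 'n) list" where ps: "round_robin ps" using round_robin_exists by blast
  interpret empirical_tournament f N "concat (replicate N ps)" by (rule E(1)[OF ps])
  have "tournament (map_tournament f N qs)" if "round_robin qs" for qs
    using empirical_tournament.tournament_rules[OF E(1)[OF that]] E(2)[OF that] by simp
  moreover have "eps_close \<epsilon> T rules"
    using close[OF ps] E(2)[OF ps] by simp
  ultimately show ?thesis
    using tm sym hon N close tournament_rules symmetric_rules[OF sym] honest_rules[OF hon]
      fixed_schedule_rules equal_meetings_rules strongly_honest_rules[OF hon]
    by blast
qed

end
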